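(* Suppose that every linking variable is integer-constrained, i.e. $L = \{i \in \{1,\dots,n_1\} \mid A^2_i \neq 0\} \subseteq \{1,\dots,r_1\}$. Then $$\min_{(x,y)\in\mathcal{F}} cx+d^1y \;=\; \min_{(x,y)\in\operatorname{conv}(\mathcal{F})} cx+d^1y .$$
   Context: Setting (mixed integer bilevel linear optimization). Let $X=\mathbb{Z}^{r_1}_+\times\mathbb{R}^{n_1-r_1}_+$ and $Y=\mathbb{Z}^{r_2}_+\times\mathbb{R}^{n_2-r_2}_+$ with $0\le r_1\le n_1$, $0\le r_2\le n_2$. The data are rational: $A^1\in\mathbb{Q}^{m_1\times n_1}$, $G^1\in\mathbb{Q}^{m_1\times n_2}$, $b^1\in\mathbb{Q}^{m_1}$, $A^2\in\mathbb{Q}^{m_2\times n_1}$, $G^2\in\mathbb{Q}^{m_2\times n_2}$, $b^2\in\mathbb{Q}^{m_2}$, $c\in\mathbb{Q}^{n_1}$, $d^1,d^2\in\mathbb{Q}^{n_2}$. $A^2_i$ denotes the $i$-th column of $A^2$; the variables $x_i$, $i\in L$, are called linking variables. For $x\in\mathbb{R}^{n_1}$ put $$\mathcal{P}_1(x)=\{y\in\mathbb{R}^{n_2}_+\mid G^1y\ge b^1-A^1x\},\qquad \mathcal{P}_2(x)=\{y\in\mathbb{R}^{n_2}_+\mid G^2y\ge b^2-A^2x\}.$$ The rational reaction set is $\mathcal{R}(x)=\operatorname{argmin}\{d^2y\mid y\in\mathcal{P}_2(x)\cap Y\}$, and the bilevel feasible region is $$\mathcal{F}=\{(x,y)\in X\times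 Y\mid y\in\mathcal{P}_1(x)\cap\mathcal{R}(x)\}.$$ Convention: the minimum is $+\infty$ over an empty set and $-\infty$ if the objective is unbounded below on the set; when the optimal value is finite, writing $\min$ means it is attained. *)

theory Defs
  imports
    Complex_Main
    "HOL-Library.Extended_Real"
    "Jordan_Normal_Form.Matrix"
begin

(* Vectors and matrices are indexed from 0, so the integer-constrained coordinates
   1, ..., r of the mathematical text are the coordinates 0, ..., r - 1 here. *)

abbreviation rvec :: "rat vec \<Rightarrow> real vec" where
  "rvec \<equiv> map_vec of_rat"

abbreviation rmat :: "rat mat \<Rightarrow> real mat" where
  "rmat \<equiv> map_mat of_rat"

definition mixed_int_orthant :: "nat \<Rightarrow> nat \<Rightarrow> real vec set" where
  "mixed_int_orthant r n = {v \<in> carrier_vec n. 0\<^sub>v n \<le> v \<and> (\<forall>i<r. v $ i \<in> \<int>)}"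

definition param_polyhedron ::
    "rat mat \<Rightarrow> rat mat \<Rightarrow> rat vec \<Rightarrow> nat \<Rightarrow> real vec \<Rightarrow> real vec set" where
  "param_polyhedron A G b n x =
     {y \<in> carrier_vec n. 0\<^sub>v n \<le> y \<and> rvec b - rmat A *\<^sub>v x \<le> rmat G *\<^sub>v y}"

definition reaction_set ::
    "rat mat \<Rightarrow> rat mat \<Rightarrow> rat vec \<Rightarrow> rat vec \<Rightarrow> nat \<Rightarrow> nat \<Rightarrow> real vec \<Rightarrow> real vec set" where
  "reaction_set A2 G2 b2 d2 r2 n2 x =
     {y. is_arg_min (\<lambda>y. rvec d2 \<bullet> y)
           (\<lambda>y. y \<in> param_polyhedron A2 G2 b2 n2 x \<inter> mixed_int_orthant r2 n2) y}"

definition bilevel_feasible ::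
    "nat \<Rightarrow> nat \<Rightarrow> nat \<Rightarrow> nat \<Rightarrow> rat mat \<Rightarrow> rat mat \<Rightarrow> rat vec \<Rightarrow>
     rat mat \<Rightarrow> rat mat \<Rightarrow> rat vec \<Rightarrow> rat vec \<Rightarrow> (real vec \<times> real vec) set" where
  "bilevel_feasible r1 n1 r2 n2 A1 G1 b1 A2 G2 b2 d2 =
     {(x, y). x \<in> mixed_int_orthant r1 n1 \<and> y \<in> mixed_int_orthant r2 n2 \<and>
              y \<in> param_polyhedron A1 G1 b1 n2 x \<inter> reaction_set A2 G2 b2 d2 r2 n2 x}"

definition linking_vars :: "rat mat \<Rightarrow> nat set" where
  "linking_vars A2 = {i. i < dim_col A2 \<and> col A2 i \<noteq> 0\<^sub>v (dim_row A2)}"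

(* The type of vectors of arbitrary dimension is not a real vector space, so convexity
   and convex hulls of sets of pairs of vectors are defined as the library does for
   the class real_vector. *)

definition convex_pairs :: "(real vec \<times> real vec) set \<Rightarrow> bool" where
  "convex_pairs S \<longleftrightarrow>
     (\<forall>p\<in>S. \<forall>q\<in>S. \<forall>u\<ge>0. \<forall>v\<ge>0. u + v = 1 \<longrightarrow>
        (u \<cdot>\<^sub>v fst p + v \<cdot>\<^sub>v fst q, u \<cdot>\<^sub>v snd p + v \<cdot>\<^sub>v snd q) \<in> S)"

definition conv :: "(real vec \<times> real vec) set \<Rightarrow> (real vec \<times> real vec) set" where
  "conv S = convex_pairs hull S"

(* \<infinity> if S is empty, -\<infinity> if f is unbounded below on S *)
definition opt_value :: "('a \<Rightarrow> real) \<Rightarrow> 'a set \<Rightarrow> ereal" where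
  "opt_value f S = (INF s\<in>S. ereal (f s))"

definition attained_if_finite :: "('a \<Rightarrow> real) \<Rightarrow> 'a set \<Rightarrow> bool" where
  "attained_if_finite f S \<longleftrightarrow>
     (\<bar>opt_value f S\<bar> \<noteq> \<infinity> \<longrightarrow> (\<exists>s\<in>S. ereal (f s) = opt_value f S))"

end

theory Submission
  imports Defs
begin

text \<open>
Passing to the convex hull does not change the infimum of a linear objective, since every
superlevel set of the objective is convex. What needs an argument is attainment: a finite
infimum over \<open>F\<close> is a minimum. The feasible region may decompose into infinitely many
pieces, one for each integer value of the linking variables, so that a minimum on each piece is not
yet a minimum on \<open>F\<close>. Attainment comes instead from the arithmetic of the data: up to domination, the objective
takes its values in \<open>(1/D)\<int>\<close> for a single \<open>D\<close>, and a nonempty subset of \<open>(1/D)\<int>\<close> that is bounded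
below has a least element.

To find \<open>D\<close>, freeze the integer coordinates of a feasible point \<open>(x, y)\<close> and minimize over the
continuous ones. Since all linking variables are frozen, the follower's problem does not
change, and \<open>(x', y')\<close> stays bilevel feasible as long as it satisfies the linear constraints of both
levels and \<open>d2 y' \<le> d2 y\<close>. This is a linear program whose coefficient matrix is the same for all
\<open>(x, y)\<close>; only its right-hand side varies, and the entries of that right-hand side are rational data,
integers, and the optimal value \<open>d2 y\<close> of the follower. By the same freezing argument, the follower's
optimal value is the value of a linear program with a fixed matrix, whose right-hand side consists of
\<open>b2 - A2 x\<close> and integers; as \<open>A2 x\<close> involves only integral coordinates of \<open>x\<close>, this right-hand side
has a bounded denominator.

Both steps rest on one fact about linear programs (\<open>lp_optimum_in_lattice\<close>): for a fixed rational
matrix and objective, the optimal values for right-hand sides in \<open>(1/K)\<int>\<close> all lie in \<open>(1/D)\<int>\<close> with one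
\<open>D\<close>. Fourier-Motzkin elimination with symbolic right-hand side proves it: eliminating the variables
from the system that says that the value \<open>t\<close> is attainable leaves finitely many rational
inequalities in \<open>t\<close> and the right-hand side, so that the optimum is the right-hand side paired with
one of finitely many rational vectors. The same elimination shows that the optimum of a bounded
linear program is attained.
\<close>

section \<open>Fourier-Motzkin elimination with parameters\<close>

definition lin_form :: "'v set \<Rightarrow> ('v \<Rightarrow> rat) \<Rightarrow> ('v \<Rightarrow> real) \<Rightarrow> real" where
  "lin_form V h v = (\<Sum>j\<in>V. of_rat (h j) * v j)"

lemma finite_sets_separated:
  fixes A B :: "real set"
  assumes "finite A" "finite B" "\<And>a b. a \<in> A \<Longrightarrow> b \<in> B \<Longrightarrow> a \<le> b"
  shows "\<exists>t. (\<forall>a\<in>A. a \<le> t) \<and> (\<forall>b\<in>B. t \<le> b)"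
proof (cases "A = {}")
  case True
  then show ?thesis
    by (metis Min_le assms(2) empty_iff)
next
  case False
  then show ?thesis
    using assms by (intro exI[of _ "Max A"]) auto
qed

text \<open>
One step of Fourier-Motzkin elimination. Constraints with positive coefficient at \<open>k\<close> bound \<open>t\<close> from
below, those with negative coefficient bound it from above, and a value \<open>t\<close> exists iff no lower bound
exceeds an upper bound. The new system \<open>H'\<close> is chosen before the assignment \<open>v\<close>: it depends on
the coefficients alone, so the other variables can serve as parameters.
\<close>

lemma eliminate_variable:
  fixes H :: "('v \<Rightarrow> rat) set"
  assumes "finite H"
  shows "\<exists>H'. finite H' \<and>
    (\<forall>v. (\<exists>t. \<forall>h\<in>H. 0 \<le> of_rat (h k) * t + lin_form V h v) \<longleftrightarrow> (\<forall>h\<in>H'. 0 \<le> lin_form V h v))"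
proof -
  define Z where "Z = {h\<in>H. h k = 0}"
  define P where "P = {h\<in>H. h k > 0}"
  define N where "N = {h\<in>H. h k < 0}"
  \<comment> \<open>The multipliers \<open>h k\<close> and \<open>- g k\<close> are positive, and they cancel the coefficient of \<open>k\<close>.\<close>
  define comb where "comb = (\<lambda>(h, g) j. h k * g j - g k * h j :: rat)"
  define H' where "H' = Z \<union> comb ` (P \<times> N)"
  have fin: "finite P" "finite N" "finite H'"
    using assms by (auto simp: P_def N_def Z_def H'_def)
  have comb: "lin_form V (comb (h, g)) v
      = of_rat (h k) * lin_form V g v - of_rat (g k) * lin_form V h v" for h g v
    by (simp add: lin_form_def comb_def sum_distrib_left sum_subtractf of_rat_diff of_rat_mult
        algebra_simps)
  have "(\<exists>t. \<forall>h\<in>H. 0 \<le> of_rat (h k) * t + lin_form V h v) \<longleftrightarrow> (\<forall>h\<in>H'. 0 \<le> lin_form V h v)" for v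
  proof
    assume "\<exists>t. \<forall>h\<in>H. 0 \<le> of_rat (h k) * t + lin_form V h v"
    then obtain t where t: "\<And>h. h \<in> H \<Longrightarrow> 0 \<le> of_rat (h k) * t + lin_form V h v"
      by blast
    have "0 \<le> lin_form V (comb (h, g)) v" if "h \<in> P" "g \<in> N" for h g
    proof -
      have h: "of_rat (h k) > (0::real)" and g: "of_rat (g k) < (0::real)"
        using that by (auto simp: P_def N_def)
      have "0 \<le> of_rat (h k) * (of_rat (g k) * t + lin_form V g v)"
        using t[of g] h that by (intro mult_nonneg_nonneg) (auto simp: N_def)
      moreover have "0 \<le> - of_rat (g k) * (of_rat (h k) * t + lin_form V h v)"
        using t[of h] g that by (intro mult_nonneg_nonneg) (auto simp: P_def)
      ultimately show ?thesis
        unfolding comb by (simp add: algebra_simps)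
    qed
    moreover have "0 \<le> lin_form V h v" if "h \<in> Z" for h
      using t[of h] that by (auto simp: Z_def)
    ultimately show "\<forall>h\<in>H'. 0 \<le> lin_form V h v"
      by (auto simp: H'_def)
  next
    assume H': "\<forall>h\<in>H'. 0 \<le> lin_form V h v"
    define r where "r h = - lin_form V h v / of_rat (h k)" for h
    have "r h \<le> r g" if "h \<in> P" "g \<in> N" for h g
    proof -
      have h: "of_rat (h k) > (0::real)" and g: "of_rat (g k) < (0::real)"
        using that by (auto simp: P_def N_def)
      have "0 \<le> of_rat (h k) * lin_form V g v - of_rat (g k) * lin_form V h v"
        using H' that unfolding comb[symmetric] by (auto simp: H'_def)
      then show ?thesis
        using h g by (simp add: r_def field_simps)
    qed
    then obtain t where tP: "\<And>h. h \<in> P \<Longrightarrow> r h \<le> t" and tN: "\<And>g. g \<in> N \<Longrightarrow> t \<le> r g"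
      using finite_sets_separated[of "r ` P" "r ` N"] fin by force
    have "0 \<le> of_rat (h k) * t + lin_form V h v" if "h \<in> H" for h
    proof (cases "h k" "0::rat" rule: linorder_cases)
      case less
      then have "of_rat (h k) < (0::real)" "t \<le> r h"
        using tN[of h] that by (auto simp: N_def)
      then show ?thesis
        by (simp add: r_def field_simps)
    next
      case equal
      then show ?thesis
        using H' that by (auto simp: H'_def Z_def)
    next
      case greater
      then have "of_rat (h k) > (0::real)" "r h \<le> t"
        using tP[of h] that by (auto simp: P_def)
      then show ?thesis
        by (simp add: r_def field_simps)
    qed
    then show "\<exists>t. \<forall>h\<in>H. 0 \<le> of_rat (h k) * t + lin_form V h v"
      by blast
  qed
  then show ?thesis
    using fin by blast
qed

lemma lin_form_cong:
  "(\<And>j. j \<in> V \<Longrightarrow> h j = h' j) \<Longrightarrow> (\<And>j. j \<in> V \<Longrightarrow> v j = v' j) \<Longrightarrow> lin_form V h v = lin_form V h' v'"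
  by (simp add: lin_form_def)

lemma lin_form_insert:
  "finite V \<Longrightarrow> k \<notin> V \<Longrightarrow> lin_form (insert k V) h v = of_rat (h k) * v k + lin_form V h v"
  by (simp add: lin_form_def)

text \<open>
The variables in \<open>V\<close> are the parameters, which survive the elimination of \<open>W\<close>. In the
induction, the variable that is to be eliminated last is first treated as a further parameter.
\<close>

lemma eliminate_variables:
  fixes H :: "('v \<Rightarrow> rat) set"
  assumes "finite W" "finite V" "W \<inter> V = {}" "finite H"
  shows "\<exists>H'. finite H' \<and>
    (\<forall>v. (\<exists>w. \<forall>h\<in>H. 0 \<le> lin_form W h w + lin_form V h v) \<longleftrightarrow> (\<forall>h\<in>H'. 0 \<le> lin_form V h v))"
  using assms
proof (induction W arbitrary: V rule: finite_induct)
  case empty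
  then show ?case
    by (intro exI[of _ H]) (auto simp: lin_form_def)
next
  case (insert k W)
  have kV: "k \<notin> V" and disj: "W \<inter> insert k V = {}"
    using insert by auto
  have "\<exists>H1. finite H1 \<and>
    (\<forall>v. (\<exists>w. \<forall>h\<in>H. 0 \<le> lin_form W h w + lin_form (insert k V) h v)
      \<longleftrightarrow> (\<forall>h\<in>H1. 0 \<le> lin_form (insert k V) h v))"
    using disj insert.prems by (intro insert.IH) auto
  then obtain H1 where H1: "finite H1"
    "\<And>v. (\<exists>w. \<forall>h\<in>H. 0 \<le> lin_form W h w + lin_form (insert k V) h v)
      \<longleftrightarrow> (\<forall>h\<in>H1. 0 \<le> lin_form (insert k V) h v)"
    by blast
  obtain H2 where H2: "finite H2"
    "\<And>v. (\<exists>t. \<forall>h\<in>H1. 0 \<le> of_rat (h k) * t + lin_form V h v) \<longleftrightarrow> (\<forall>h\<in>H2. 0 \<le> lin_form V h v)"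
    using eliminate_variable[OF H1(1), of k V] by blast
  have upd: "lin_form (insert k V) h (v(k := t)) = of_rat (h k) * t + lin_form V h v" for h v t
    using kV insert.prems by (simp add: lin_form_insert) (auto intro: lin_form_cong)
  have ins: "lin_form (insert k W) h (w(k := t)) = of_rat (h k) * t + lin_form W h w" for h w t
    using insert by (simp add: lin_form_insert) (auto intro: lin_form_cong)
  have "(\<exists>w. \<forall>h\<in>H. 0 \<le> lin_form (insert k W) h w + lin_form V h v)
      \<longleftrightarrow> (\<forall>h\<in>H2. 0 \<le> lin_form V h v)" for v
  proof -
    have "(\<exists>w. \<forall>h\<in>H. 0 \<le> lin_form (insert k W) h w + lin_form V h v)
      \<longleftrightarrow> (\<exists>t w. \<forall>h\<in>H. 0 \<le> lin_form (insert k W) h (w(k := t)) + lin_form V h v)"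
      by (metis fun_upd_triv)
    also have "\<dots> \<longleftrightarrow> (\<exists>t w. \<forall>h\<in>H. 0 \<le> lin_form W h w + lin_form (insert k V) h (v(k := t)))"
      unfolding upd ins by (simp add: algebra_simps)
    finally show ?thesis
      unfolding H1(2) unfolding upd H2(2) .
  qed
  then show ?case
    using H2(1) by blast
qed

section \<open>Linear programs whose right-hand sides have bounded denominators\<close>

lemma common_denominator:
  assumes "finite Q"
  shows "\<exists>D::nat. 0 < D \<and> (\<forall>q\<in>Q. of_nat D * real_of_rat q \<in> \<int>)"
  using assms
proof (induction Q rule: finite_induct)
  case empty
  then show ?case by auto
next
  case (insert q Q)
  then obtain D where D: "0 < D" "\<And>q. q \<in> Q \<Longrightarrow> of_nat D * real_of_rat q \<in> \<int>"
    by blast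
  obtain m n where q: "quotient_of q = (m, n)"
    by force
  then have n: "n > 0" and qn: "q = of_int m / of_int n"
    using quotient_of_denom_pos quotient_of_div by auto
  have "of_nat (nat n * D) * real_of_rat q = of_int (m * int D)"
    using n by (simp add: qn of_rat_divide field_simps)
  moreover have "of_nat (nat n * D) * real_of_rat q' \<in> \<int>" if "q' \<in> Q" for q'
    using D(2)[OF that] by (simp add: mult.assoc)
  ultimately show ?case
    using D(1) n by (intro exI[of _ "nat n * D"]) (metis Ints_of_int insertE mult_pos_pos zero_less_nat_eq)
qed

text \<open>
A feasible and bounded linear program has an optimal solution, and the denominator of
the optimal value is controlled uniformly over all right-hand sides \<open>b\<close> in \<open>(1/K)\<int>\<close>.
The parameters of the elimination are the value \<open>t\<close> and the entries of \<open>b\<close>; it turns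
attainability of \<open>t\<close> into finitely many conditions \<open>0 \<le> \<alpha> h * t + \<beta> b h\<close>, where \<open>\<alpha> h\<close> is a rational number
and \<open>\<beta> b h\<close> a rational linear form in \<open>b\<close>. Boundedness forces some \<open>\<alpha> h\<close> to be positive, and
the optimum is the largest of the lower bounds \<open>- \<beta> b h / \<alpha> h\<close>.
\<close>

lemma lp_optimum_in_lattice:
  fixes a :: "'i \<Rightarrow> 'v \<Rightarrow> rat" and c :: "'v \<Rightarrow> rat" and K :: nat
  assumes "finite I" "finite J" "0 < K"
  shows "\<exists>D::nat. 0 < D \<and> (\<forall>b z B.
    (\<forall>i\<in>I. of_nat K * b i \<in> \<int>) \<longrightarrow>
    (\<forall>i\<in>I. b i \<le> lin_form J (a i) z) \<longrightarrow>
    (\<forall>w. (\<forall>i\<in>I. b i \<le> lin_form J (a i) w) \<longrightarrow> B \<le> lin_form J c w) \<longrightarrow>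
    (\<exists>w. (\<forall>i\<in>I. b i \<le> lin_form J (a i) w) \<and> lin_form J c w \<le> lin_form J c z \<and>
         of_nat D * lin_form J c w \<in> \<int>))"
proof -
  \<comment> \<open>Parameters: \<open>Inr None\<close> stands for the value \<open>t\<close>, and \<open>Inr (Some i)\<close> for the right-hand side \<open>b i\<close>.\<close>
  define W :: "('v + 'i option) set" where "W = Inl ` J"
  define V :: "('v + 'i option) set" where "V = insert (Inr None) ((Inr \<circ> Some) ` I)"
  define row :: "'i \<Rightarrow> 'v + 'i option \<Rightarrow> rat" where
    "row i = case_sum (a i) (\<lambda>k. if k = Some i then - 1 else 0)" for i
  define val :: "rat \<Rightarrow> 'v + 'i option \<Rightarrow> rat" where
    "val s = case_sum (\<lambda>j. s * c j) (\<lambda>k. if k = None then - s else 0)" for s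
  \<comment> \<open>The two constraints \<open>val 1\<close> and \<open>val (- 1)\<close> together say that the objective equals \<open>t\<close>.\<close>
  define H where "H = row ` I \<union> {val 1, val (- 1)}"
  define par :: "real \<Rightarrow> ('i \<Rightarrow> real) \<Rightarrow> 'v + 'i option \<Rightarrow> real" where
    "par t b = case_sum (\<lambda>_. 0) (case_option t b)" for t b
  have lin_W: "lin_form W h w = lin_form J (h \<circ> Inl) (w \<circ> Inl)" for h w
    by (simp add: lin_form_def W_def sum.reindex)
  have lin_V: "lin_form V h (par t b)
      = of_rat (h (Inr None)) * t + (\<Sum>i\<in>I. of_rat (h (Inr (Some i))) * b i)" for h t b
    using assms by (simp add: lin_form_def V_def par_def sum.reindex inj_on_def comp_def image_iff)
  have row_J: "lin_form J (row i \<circ> Inl) z = lin_form J (a i) z" for i z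
    by (simp add: row_def lin_form_def)
  have val_J: "lin_form J (val s \<circ> Inl) z = of_rat s * lin_form J c z" for s z
    by (simp add: val_def lin_form_def of_rat_mult sum_distrib_left mult.assoc)
  have row_V: "lin_form V (row i) (par t b) = - b i" if "i \<in> I" for i t b
  proof -
    have "lin_form V (row i) (par t b) = (\<Sum>k\<in>I. if k = i then - b k else 0)"
      unfolding lin_V by (simp add: row_def) (intro sum.cong, auto)
    then show ?thesis
      using assms that by simp
  qed
  have val_V: "lin_form V (val s) (par t b) = - of_rat s * t" for s t b
    unfolding lin_V by (simp add: val_def of_rat_minus)
  obtain H' where H': "finite H'"
    "\<And>v. (\<exists>w. \<forall>h\<in>H. 0 \<le> lin_form W h w + lin_form V h v) \<longleftrightarrow> (\<forall>h\<in>H'. 0 \<le> lin_form V h v)"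
    using eliminate_variables[of W V H] assms by (auto simp: W_def V_def H_def)
  define \<alpha> where "\<alpha> h = real_of_rat (h (Inr None))" for h :: "'v + 'i option \<Rightarrow> rat"
  define \<beta> where "\<beta> b h = (\<Sum>i\<in>I. of_rat (h (Inr (Some i))) * b i)"
    for b :: "'i \<Rightarrow> real" and h :: "'v + 'i option \<Rightarrow> rat"
  have attainable: "(\<exists>w. (\<forall>i\<in>I. b i \<le> lin_form J (a i) w) \<and> lin_form J c w = t)
      \<longleftrightarrow> (\<forall>h\<in>H'. 0 \<le> \<alpha> h * t + \<beta> b h)" for b t
  proof -
    have "(\<exists>w. \<forall>h\<in>H. 0 \<le> lin_form W h w + lin_form V h (par t b))
      \<longleftrightarrow> (\<exists>w :: 'v + 'i option \<Rightarrow> real. (\<forall>i\<in>I. b i \<le> lin_form J (a i) (w \<circ> Inl)) \<and> lin_form J c (w \<circ> Inl) = t)"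
    proof -
      have "(\<forall>h\<in>H. 0 \<le> lin_form W h w + lin_form V h (par t b))
        \<longleftrightarrow> (\<forall>i\<in>I. b i \<le> lin_form J (a i) (w \<circ> Inl)) \<and> lin_form J c (w \<circ> Inl) = t" for w
        unfolding H_def lin_W ball_Un ball_simps
        by (simp add: row_J val_J row_V val_V of_rat_minus) linarith
      then show ?thesis
        by simp
    qed
    also have "\<dots> \<longleftrightarrow> (\<exists>w. (\<forall>i\<in>I. b i \<le> lin_form J (a i) w) \<and> lin_form J c w = t)"
    proof
      assume "\<exists>w. (\<forall>i\<in>I. b i \<le> lin_form J (a i) w) \<and> lin_form J c w = t"
      then obtain w where "(\<forall>i\<in>I. b i \<le> lin_form J (a i) w) \<and> lin_form J c w = t" ..
      then show "\<exists>w :: 'v + 'i option \<Rightarrow> real. (\<forall>i\<in>I. b i \<le> lin_form J (a i) (w \<circ> Inl)) \<and> lin_form J c (w \<circ> Inl) = t"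
        by (intro exI[of _ "case_sum w (\<lambda>_. 0)"]) (simp add: comp_def)
    qed blast
    finally show ?thesis
      unfolding H'(2) by (simp add: lin_V \<alpha>_def \<beta>_def)
  qed
  obtain D where D: "0 < D"
    "\<And>h i. h \<in> H' \<Longrightarrow> i \<in> I \<Longrightarrow> of_nat D * real_of_rat (h (Inr (Some i)) / h (Inr None)) \<in> \<int>"
    using common_denominator[of "(\<lambda>(h, i). h (Inr (Some i)) / h (Inr None)) ` (H' \<times> I)"] H'(1) assms
    by force
  show ?thesis
  proof (intro exI[of _ "D * K"] conjI allI impI)
    show "0 < D * K"
      using D assms by simp
  next
    fix b z B
    assume b: "\<forall>i\<in>I. of_nat K * b i \<in> \<int>" and z: "\<forall>i\<in>I. b i \<le> lin_form J (a i) z"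
      and B: "\<forall>w. (\<forall>i\<in>I. b i \<le> lin_form J (a i) w) \<longrightarrow> B \<le> lin_form J c w"
    define t0 where "t0 = lin_form J c z"
    have t0: "0 \<le> \<alpha> h * t0 + \<beta> b h" if "h \<in> H'" for h
      using attainable[of b t0] z that t0_def by blast
    define G where "G = {h\<in>H'. \<alpha> h > 0}"
    define T where "T = (\<lambda>h. - \<beta> b h / \<alpha> h) ` G"
    have below: "0 \<le> \<alpha> h * t + \<beta> b h" if "h \<in> H'" "h \<notin> G" "t \<le> t0" for h t
    proof -
      have "\<alpha> h * t0 \<le> \<alpha> h * t"
        using that by (intro mult_left_mono_neg) (auto simp: G_def)
      then show ?thesis
        using t0[OF that(1)] by linarith
    qed
    \<comment> \<open>Without a lower bound on \<open>t\<close>, a value below \<open>B\<close> would be attainable.\<close>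
    have "G \<noteq> {}"
    proof
      assume "G = {}"
      then have "\<forall>h\<in>H'. 0 \<le> \<alpha> h * min t0 (B - 1) + \<beta> b h"
        using below by simp
      then obtain w where "\<forall>i\<in>I. b i \<le> lin_form J (a i) w" "lin_form J c w = min t0 (B - 1)"
        using attainable by blast
      then show False
        using B by fastforce
    qed
    then have T: "finite T" "T \<noteq> {}"
      using H'(1) by (auto simp: T_def G_def)
    define t where "t = Max T"
    have "t \<in> T"
      using T t_def by simp
    then obtain g where g: "g \<in> H'" "\<alpha> g > 0" "t = - \<beta> b g / \<alpha> g"
      by (auto simp: T_def G_def)
    have tt0: "t \<le> t0"
      unfolding g(3) using g(2) t0[OF g(1)] by (simp add: field_simps)
    have "0 \<le> \<alpha> h * t + \<beta> b h" if "h \<in> H'" for h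
    proof (cases "h \<in> G")
      case True
      then have "- \<beta> b h / \<alpha> h \<le> t"
        unfolding t_def using T by (intro Max_ge) (auto simp: T_def)
      then show ?thesis
        using True by (simp add: G_def field_simps)
    qed (use below tt0 that in blast)
    then obtain w where w: "\<forall>i\<in>I. b i \<le> lin_form J (a i) w" "lin_form J c w = t"
      using attainable by blast
    have "of_nat (D * K) * t
        = - (\<Sum>i\<in>I. (of_nat D * real_of_rat (g (Inr (Some i)) / g (Inr None))) * (of_nat K * b i))"
      by (simp add: g(3) \<beta>_def \<alpha>_def of_rat_divide sum_divide_distrib sum_distrib_left
          sum_negf[symmetric] algebra_simps)
    also have "\<dots> \<in> \<int>"
      using b D(2)[OF g(1)] by (intro Ints_minus Ints_sum) (rule Ints_mult, auto)
    finally show "\<exists>w. (\<forall>i\<in>I. b i \<le> lin_form J (a i) w) \<and> lin_form J c w \<le> lin_form J c z \<and>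
         of_nat (D * K) * lin_form J c w \<in> \<int>"
      using w tt0 t0_def by blast
  qed
qed

text \<open>
The continuous coordinates of a mixed integer point can be optimized while the integral ones,
those in \<open>N\<close>, stay fixed. Fixing \<open>w j = z j\<close> amounts to two inequalities whose right-hand sides
are the integers \<open>z j\<close> and \<open>- z j\<close>, so the values that are fixed enter only through the right-hand side
and do not affect \<open>D\<close>.
\<close>

lemma mixed_integer_optimum_in_lattice:
  fixes a :: "'i \<Rightarrow> 'v \<Rightarrow> rat" and c :: "'v \<Rightarrow> rat" and K :: nat
  assumes "finite I" "finite J" "N \<subseteq> J" "0 < K"
  shows "\<exists>D::nat. 0 < D \<and> (\<forall>b z B.
    (\<forall>i\<in>I. of_nat K * b i \<in> \<int>) \<longrightarrow>
    (\<forall>j\<in>J. 0 \<le> z j) \<longrightarrow> (\<forall>j\<in>N. z j \<in> \<int>) \<longrightarrow> (\<forall>i\<in>I. b i \<le> lin_form J (a i) z) \<longrightarrow>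
    (\<forall>w. (\<forall>j\<in>J. 0 \<le> w j) \<longrightarrow> (\<forall>j\<in>N. w j = z j) \<longrightarrow> (\<forall>i\<in>I. b i \<le> lin_form J (a i) w) \<longrightarrow>
         B \<le> lin_form J c w) \<longrightarrow>
    (\<exists>w. (\<forall>j\<in>J. 0 \<le> w j) \<and> (\<forall>j\<in>N. w j = z j) \<and> (\<forall>i\<in>I. b i \<le> lin_form J (a i) w) \<and>
         lin_form J c w \<le> lin_form J c z \<and> of_nat D * lin_form J c w \<in> \<int>))"
proof -
  define I' :: "('i + 'v + 'v) set" where "I' = I <+> (J <+> N)"
  \<comment> \<open>Multiples of unit rows: lower bounds for all variables, upper bounds for those in \<open>N\<close>.\<close>
  define e :: "rat \<Rightarrow> 'v \<Rightarrow> 'v \<Rightarrow> rat" where "e s j k = (if k = j then s else 0)" for s j k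
  define a' where "a' = case_sum a (case_sum (e 1) (e (- 1)))"
  define b' where "b' b z = case_sum b (case_sum (\<lambda>j. if j \<in> N then z j else 0) (\<lambda>j. - z j))"
    for b :: "'i \<Rightarrow> real" and z :: "'v \<Rightarrow> real"
  have e: "lin_form J (e s j) w = of_rat s * w j" if "j \<in> J" for s j w
  proof -
    have "lin_form J (e s j) w = (\<Sum>k\<in>J. if k = j then of_rat s * w k else 0)"
      by (auto simp: lin_form_def e_def intro: sum.cong)
    then show ?thesis
      using assms that by simp
  qed
  have fin: "finite I'"
    using assms by (simp add: I'_def finite_subset)
  have feasible: "(\<forall>i\<in>I'. b' b z i \<le> lin_form J (a' i) w) \<longleftrightarrow>
      (\<forall>j\<in>J. 0 \<le> w j) \<and> (\<forall>j\<in>N. w j = z j) \<and> (\<forall>i\<in>I. b i \<le> lin_form J (a i) w)"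
    if z: "\<forall>j\<in>J. 0 \<le> z j" for b z w
  proof -
    have lower: "(\<forall>j\<in>J. (if j \<in> N then z j else 0) \<le> lin_form J (e 1 j) w) \<longleftrightarrow>
        (\<forall>j\<in>J. (if j \<in> N then z j else 0) \<le> w j)"
      by (simp add: e)
    have upper: "(\<forall>j\<in>N. - z j \<le> lin_form J (e (- 1) j) w) \<longleftrightarrow> (\<forall>j\<in>N. w j \<le> z j)"
    proof (intro ball_cong refl)
      fix j assume "j \<in> N"
      then have "j \<in> J"
        using assms(3) by blast
      then show "- z j \<le> lin_form J (e (- 1) j) w \<longleftrightarrow> w j \<le> z j"
        by (simp add: e of_rat_minus)
    qed
    have bounds: "(\<forall>j\<in>J. (if j \<in> N then z j else 0) \<le> w j) \<and> (\<forall>j\<in>N. w j \<le> z j) \<longleftrightarrow>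
        (\<forall>j\<in>J. 0 \<le> w j) \<and> (\<forall>j\<in>N. w j = z j)"
    proof (intro iffI conjI ballI; elim conjE)
      fix j assume w: "\<forall>j\<in>J. (if j \<in> N then z j else 0) \<le> w j"
        and "\<forall>j\<in>N. w j \<le> z j"
      { assume "j \<in> J"
        then have "0 \<le> z j" "(if j \<in> N then z j else 0) \<le> w j"
          using w z by blast+
        then show "0 \<le> w j"
          by (simp split: if_splits) }
      assume "j \<in> N"
      then have "j \<in> J" "w j \<le> z j"
        using assms(3) \<open>\<forall>j\<in>N. w j \<le> z j\<close> by blast+
      moreover have "(if j \<in> N then z j else 0) \<le> w j"
        using w \<open>j \<in> J\<close> by blast
      ultimately show "w j = z j"
        using \<open>j \<in> N\<close> by simp
    qed auto
    have "(\<forall>i\<in>I'. b' b z i \<le> lin_form J (a' i) w) \<longleftrightarrow>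
        (\<forall>i\<in>I. b i \<le> lin_form J (a i) w) \<and>
        (\<forall>j\<in>J. (if j \<in> N then z j else 0) \<le> lin_form J (e 1 j) w) \<and>
        (\<forall>j\<in>N. - z j \<le> lin_form J (e (- 1) j) w)"
      by (simp add: I'_def a'_def b'_def Plus_def ball_Un del: if_split)
    then show ?thesis
      unfolding lower upper bounds by blast
  qed
  have lattice: "\<forall>i\<in>I'. of_nat K * b' b z i \<in> \<int>"
    if "\<forall>i\<in>I. of_nat K * b i \<in> \<int>" "\<forall>j\<in>N. z j \<in> \<int>" for b z
    using that by (auto simp: I'_def b'_def)
  obtain D where D_pos: "0 < D" and D: "\<forall>b z B.
    (\<forall>i\<in>I'. of_nat K * b i \<in> \<int>) \<longrightarrow>
    (\<forall>i\<in>I'. b i \<le> lin_form J (a' i) z) \<longrightarrow>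
    (\<forall>w. (\<forall>i\<in>I'. b i \<le> lin_form J (a' i) w) \<longrightarrow> B \<le> lin_form J c w) \<longrightarrow>
    (\<exists>w. (\<forall>i\<in>I'. b i \<le> lin_form J (a' i) w) \<and> lin_form J c w \<le> lin_form J c z \<and>
         of_nat D * lin_form J c w \<in> \<int>)"
    using lp_optimum_in_lattice[OF fin assms(2,4), of a' c] by (elim exE conjE) (rule that)
  show ?thesis
  proof (intro exI[of _ D] conjI allI impI)
    fix b z B
    assume b: "\<forall>i\<in>I. of_nat K * b i \<in> \<int>" and z: "\<forall>j\<in>J. 0 \<le> z j" "\<forall>j\<in>N. z j \<in> \<int>"
      "\<forall>i\<in>I. b i \<le> lin_form J (a i) z"
      and B: "\<forall>w. (\<forall>j\<in>J. 0 \<le> w j) \<longrightarrow> (\<forall>j\<in>N. w j = z j) \<longrightarrow>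
        (\<forall>i\<in>I. b i \<le> lin_form J (a i) w) \<longrightarrow> B \<le> lin_form J c w"
    have z': "\<forall>i\<in>I'. b' b z i \<le> lin_form J (a' i) z"
      unfolding feasible[OF z(1)] using z by simp
    have B': "\<forall>w. (\<forall>i\<in>I'. b' b z i \<le> lin_form J (a' i) w) \<longrightarrow> B \<le> lin_form J c w"
      unfolding feasible[OF z(1)] using B by simp
    show "\<exists>w. (\<forall>j\<in>J. 0 \<le> w j) \<and> (\<forall>j\<in>N. w j = z j) \<and> (\<forall>i\<in>I. b i \<le> lin_form J (a i) w) \<and>
         lin_form J c w \<le> lin_form J c z \<and> of_nat D * lin_form J c w \<in> \<int>"
      using D[THEN spec, THEN spec, THEN spec, THEN mp, OF lattice[OF b z(2)],
          THEN mp, OF z', THEN mp, OF B']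
      unfolding feasible[OF z(1)] by (simp only: conj_assoc)
  qed (rule D_pos)
qed

section \<open>Coordinate form of the bilevel problem\<close>

lemma scalar_prod_rvec:
  assumes "d \<in> carrier_vec n" "y \<in> carrier_vec n"
  shows "rvec d \<bullet> y = lin_form {..<n} (($) d) (($) y)"
  using assms by (auto simp: scalar_prod_def lin_form_def atLeast0LessThan intro: sum.cong)

lemma mult_rmat_index:
  assumes "A \<in> carrier_mat m n" "x \<in> carrier_vec n" "i < m"
  shows "(rmat A *\<^sub>v x) $ i = lin_form {..<n} (\<lambda>j. A $$ (i, j)) (($) x)"
  using assms by (auto simp: scalar_prod_def lin_form_def atLeast0LessThan intro: sum.cong)

lemma mem_param_polyhedron_iff:
  assumes "A \<in> carrier_mat m n1" "G \<in> carrier_mat m n2" "b \<in> carrier_vec m"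
    and "x \<in> carrier_vec n1"
  shows "y \<in> param_polyhedron A G b n2 x \<longleftrightarrow>
    y \<in> carrier_vec n2 \<and> (\<forall>j<n2. 0 \<le> y $ j) \<and>
    (\<forall>i<m. of_rat (b $ i) - lin_form {..<n1} (\<lambda>j. A $$ (i, j)) (($) x)
      \<le> lin_form {..<n2} (\<lambda>j. G $$ (i, j)) (($) y))"
proof (cases "y \<in> carrier_vec n2")
  case True
  have rows: "rvec b - rmat A *\<^sub>v x \<le> rmat G *\<^sub>v y \<longleftrightarrow>
    (\<forall>i<m. of_rat (b $ i) - lin_form {..<n1} (\<lambda>j. A $$ (i, j)) (($) x)
      \<le> lin_form {..<n2} (\<lambda>j. G $$ (i, j)) (($) y))"
    using assms mult_rmat_index[OF assms(1,4)] mult_rmat_index[OF assms(2) True]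
    by (simp add: less_eq_vec_def del: index_mult_mat_vec)
  have signs: "0\<^sub>v n2 \<le> y \<longleftrightarrow> (\<forall>j<n2. 0 \<le> y $ j)"
    using True by (auto simp: less_eq_vec_def)
  show ?thesis
    unfolding param_polyhedron_def mem_Collect_eq rows signs ..
qed (simp add: param_polyhedron_def)

lemma mem_mixed_int_orthant_iff:
  "v \<in> mixed_int_orthant r n \<longleftrightarrow>
    v \<in> carrier_vec n \<and> (\<forall>j<n. 0 \<le> v $ j) \<and> (\<forall>j<r. v $ j \<in> \<int>)"
  by (auto simp: mixed_int_orthant_def less_eq_vec_def)

text \<open>
The columns of variables that are not linking vanish, so the product with \<open>A\<close> sees only the integral
coordinates of \<open>x\<close>.
\<close>

lemma lin_form_linking:
  assumes "A \<in> carrier_mat m n" "linking_vars A \<subseteq> {..<r}" "r \<le> n" "i < m"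
  shows "lin_form {..<n} (\<lambda>j. A $$ (i, j)) x = lin_form {..<r} (\<lambda>j. A $$ (i, j)) x"
  unfolding lin_form_def
proof (rule sum.mono_neutral_right)
  show "\<forall>j\<in>{..<n} - {..<r}. of_rat (A $$ (i, j)) * x j = 0"
  proof
    fix j assume j: "j \<in> {..<n} - {..<r}"
    then have "j \<notin> linking_vars A"
      using assms(2) by auto
    then have "col A j = 0\<^sub>v m"
      using j assms(1) by (auto simp: linking_vars_def)
    then have "col A j $ i = 0"
      using assms(4) by simp
    then have "A $$ (i, j) = 0"
      using j assms(1,4) by simp
    then show "of_rat (A $$ (i, j)) * x j = 0"
      by simp
  qed
qed (use assms(3) in auto)

lemma param_polyhedron_linking_cong:
  assumes "A \<in> carrier_mat m n1" "G \<in> carrier_mat m n2" "b \<in> carrier_vec m"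
    and "linking_vars A \<subseteq> {..<r}" "r \<le> n1"
    and "x \<in> carrier_vec n1" "x' \<in> carrier_vec n1" "\<And>j. j < r \<Longrightarrow> x' $ j = x $ j"
  shows "param_polyhedron A G b n2 x' = param_polyhedron A G b n2 x"
proof -
  have "lin_form {..<n1} (\<lambda>j. A $$ (i, j)) (($) x') = lin_form {..<n1} (\<lambda>j. A $$ (i, j)) (($) x)"
    if "i < m" for i
    unfolding lin_form_linking[OF assms(1,4,5) that] using assms(8) by (intro lin_form_cong) auto
  then show ?thesis
    using mem_param_polyhedron_iff[OF assms(1-3)] assms(6,7) by auto
qed

section \<open>Values of the two levels\<close>

text \<open>
For a follower's optimal solution \<open>y\<close>, moving the continuous coordinates cannot improve the objective,
so its value is the optimum of the linear program in which the integral coordinates of \<open>y\<close> are fixed.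
Linking variables being integral, the right-hand side \<open>b - A x\<close> of that program has a denominator which
does not depend on \<open>x\<close>.
\<close>

lemma reaction_value_in_lattice:
  assumes A: "A \<in> carrier_mat m n1" and G: "G \<in> carrier_mat m n2" and b: "b \<in> carrier_vec m"
    and d: "d \<in> carrier_vec n2"
    and link: "linking_vars A \<subseteq> {..<r1}" "r1 \<le> n1" and r2: "r2 \<le> n2"
  shows "\<exists>D::nat. 0 < D \<and> (\<forall>x\<in>mixed_int_orthant r1 n1. \<forall>y\<in>reaction_set A G b d r2 n2 x.
    of_nat D * (rvec d \<bullet> y) \<in> \<int>)"
proof -
  let ?data = "($) b ` {..<m} \<union> ($$) A ` ({..<m} \<times> {..<n1})"
  have "finite ?data"
    by simp
  from common_denominator[OF this] obtain K :: nat where K: "0 < K"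
    and K_data: "\<forall>q\<in>?data. of_nat K * real_of_rat q \<in> \<int>"
    by (elim exE conjE) (rule that)
  have Kb: "of_nat K * real_of_rat (b $ i) \<in> \<int>" if "i < m" for i
    by (intro K_data[rule_format] UnI1 imageI) (use that in simp)
  have KA: "of_nat K * real_of_rat (A $$ (i, j)) \<in> \<int>" if "i < m" "j < n1" for i j
    by (intro K_data[rule_format] UnI2 imageI) (use that in simp)
  obtain D where D_pos: "0 < D" and D: "\<forall>\<beta> z B.
    (\<forall>i\<in>{..<m}. of_nat K * \<beta> i \<in> \<int>) \<longrightarrow>
    (\<forall>j\<in>{..<n2}. 0 \<le> z j) \<longrightarrow> (\<forall>j\<in>{..<r2}. z j \<in> \<int>) \<longrightarrow>
    (\<forall>i\<in>{..<m}. \<beta> i \<le> lin_form {..<n2} (\<lambda>j. G $$ (i, j)) z) \<longrightarrow>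
    (\<forall>w. (\<forall>j\<in>{..<n2}. 0 \<le> w j) \<longrightarrow> (\<forall>j\<in>{..<r2}. w j = z j) \<longrightarrow>
         (\<forall>i\<in>{..<m}. \<beta> i \<le> lin_form {..<n2} (\<lambda>j. G $$ (i, j)) w) \<longrightarrow>
         B \<le> lin_form {..<n2} (($) d) w) \<longrightarrow>
    (\<exists>w. (\<forall>j\<in>{..<n2}. 0 \<le> w j) \<and> (\<forall>j\<in>{..<r2}. w j = z j) \<and>
         (\<forall>i\<in>{..<m}. \<beta> i \<le> lin_form {..<n2} (\<lambda>j. G $$ (i, j)) w) \<and>
         lin_form {..<n2} (($) d) w \<le> lin_form {..<n2} (($) d) z \<and>
         of_nat D * lin_form {..<n2} (($) d) w \<in> \<int>)"
    using mixed_integer_optimum_in_lattice[OF finite_lessThan finite_lessThan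
        lessThan_subset_iff[THEN iffD2, OF r2] K, of m "\<lambda>i j. G $$ (i, j)" "($) d"]
    by (elim exE conjE) (rule that)
  have "of_nat D * (rvec d \<bullet> y) \<in> \<int>"
    if x: "x \<in> mixed_int_orthant r1 n1" and y: "y \<in> reaction_set A G b d r2 n2 x" for x y
  proof -
    define \<beta> where "\<beta> i = of_rat (b $ i) - lin_form {..<n1} (\<lambda>j. A $$ (i, j)) (($) x)" for i
    have xc: "x \<in> carrier_vec n1"
      using x by (simp add: mem_mixed_int_orthant_iff)
    have poly: "v \<in> param_polyhedron A G b n2 x \<longleftrightarrow> v \<in> carrier_vec n2 \<and> (\<forall>j<n2. 0 \<le> v $ j) \<and>
        (\<forall>i<m. \<beta> i \<le> lin_form {..<n2} (\<lambda>j. G $$ (i, j)) (($) v))" for v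
      unfolding \<beta>_def by (rule mem_param_polyhedron_iff[OF A G b xc])
    have y_feas: "y \<in> param_polyhedron A G b n2 x" "y \<in> mixed_int_orthant r2 n2"
      and y_min: "\<And>v. v \<in> param_polyhedron A G b n2 x \<Longrightarrow> v \<in> mixed_int_orthant r2 n2 \<Longrightarrow>
        rvec d \<bullet> y \<le> rvec d \<bullet> v"
      using y by (auto simp: reaction_set_def is_arg_min_def not_less)
    have yc: "y \<in> carrier_vec n2"
      using y_feas by (simp add: mem_mixed_int_orthant_iff)
    have lattice: "\<forall>i\<in>{..<m}. of_nat K * \<beta> i \<in> \<int>"
    proof
      fix i assume "i \<in> {..<m}"
      then have i: "i < m" by simp
      have "of_nat K * lin_form {..<r1} (\<lambda>j. A $$ (i, j)) (($) x)
          = (\<Sum>j<r1. (of_nat K * of_rat (A $$ (i, j))) * x $ j)"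
        by (simp add: lin_form_def sum_distrib_left mult.assoc)
      also have "\<dots> \<in> \<int>"
        using x KA[OF i] link(2) by (intro Ints_sum) (rule Ints_mult, auto simp: mem_mixed_int_orthant_iff)
      finally show "of_nat K * \<beta> i \<in> \<int>"
        unfolding \<beta>_def lin_form_linking[OF A link i] right_diff_distrib using Kb[OF i] by simp
    qed
    have lower: "\<forall>w. (\<forall>j\<in>{..<n2}. 0 \<le> w j) \<longrightarrow> (\<forall>j\<in>{..<r2}. w j = y $ j) \<longrightarrow>
         (\<forall>i\<in>{..<m}. \<beta> i \<le> lin_form {..<n2} (\<lambda>j. G $$ (i, j)) w) \<longrightarrow>
         rvec d \<bullet> y \<le> lin_form {..<n2} (($) d) w"
    proof (intro allI impI)
      fix w assume w: "\<forall>j\<in>{..<n2}. 0 \<le> w j" "\<forall>j\<in>{..<r2}. w j = y $ j"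
        "\<forall>i\<in>{..<m}. \<beta> i \<le> lin_form {..<n2} (\<lambda>j. G $$ (i, j)) w"
      have lin: "lin_form {..<n2} h (($) (vec n2 w)) = lin_form {..<n2} h w" for h
        by (rule lin_form_cong) auto
      have "vec n2 w \<in> param_polyhedron A G b n2 x" "vec n2 w \<in> mixed_int_orthant r2 n2"
        using w y_feas(2) r2 by (auto simp: poly lin mem_mixed_int_orthant_iff)
      then show "rvec d \<bullet> y \<le> lin_form {..<n2} (($) d) w"
        using y_min[of "vec n2 w"] scalar_prod_rvec[OF d, of "vec n2 w"] lin by simp
    qed
    obtain w where w: "\<forall>j\<in>{..<n2}. 0 \<le> w j" "\<forall>j\<in>{..<r2}. w j = y $ j"
      "\<forall>i\<in>{..<m}. \<beta> i \<le> lin_form {..<n2} (\<lambda>j. G $$ (i, j)) w"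
      "lin_form {..<n2} (($) d) w \<le> rvec d \<bullet> y" "of_nat D * lin_form {..<n2} (($) d) w \<in> \<int>"
      using D[THEN spec, THEN spec, THEN spec, THEN mp, OF lattice, THEN mp, of "($) y",
          THEN mp, THEN mp, THEN mp, OF _ _ _ lower] y_feas
      unfolding poly scalar_prod_rvec[OF d yc, symmetric] mem_mixed_int_orthant_iff by auto
    then have "lin_form {..<n2} (($) d) w = rvec d \<bullet> y"
      using lower by (intro antisym) auto
    then show ?thesis
      using w(5) by simp
  qed
  then show ?thesis
    using D_pos by blast
qed

text \<open>
Changing only non-linking coordinates of \<open>x\<close> leaves the follower's problem as it is, so a follower's
solution remains optimal if its objective value does not increase.
\<close>

lemma bilevel_feasible_exchange:
  assumes A2: "A2 \<in> carrier_mat m2 n1" and G2: "G2 \<in> carrier_mat m2 n2" and b2: "b2 \<in> carrier_vec m2"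
    and link: "linking_vars A2 \<subseteq> {..<r1}" "r1 \<le> n1"
    and xy: "(x, y) \<in> bilevel_feasible r1 n1 r2 n2 A1 G1 b1 A2 G2 b2 d2"
    and x': "x' \<in> mixed_int_orthant r1 n1" "\<And>j. j < r1 \<Longrightarrow> x' $ j = x $ j"
    and y': "y' \<in> mixed_int_orthant r2 n2" "y' \<in> param_polyhedron A1 G1 b1 n2 x'"
      "y' \<in> param_polyhedron A2 G2 b2 n2 x'" "rvec d2 \<bullet> y' \<le> rvec d2 \<bullet> y"
  shows "(x', y') \<in> bilevel_feasible r1 n1 r2 n2 A1 G1 b1 A2 G2 b2 d2"
proof -
  have "x \<in> carrier_vec n1" "x' \<in> carrier_vec n1"
    using xy x'(1) by (auto simp: bilevel_feasible_def mem_mixed_int_orthant_iff)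
  then have "param_polyhedron A2 G2 b2 n2 x' = param_polyhedron A2 G2 b2 n2 x"
    using param_polyhedron_linking_cong[OF A2 G2 b2 link] x'(2) by blast
  then have "y' \<in> reaction_set A2 G2 b2 d2 r2 n2 x'"
    using xy y' by (fastforce simp: bilevel_feasible_def reaction_set_def is_arg_min_def)
  then show ?thesis
    using x' y' by (simp add: bilevel_feasible_def)
qed

lemma lin_form_Plus:
  assumes "finite A" "finite B"
  shows "lin_form (A <+> B) (case_sum f g) z = lin_form A f (z \<circ> Inl) + lin_form B g (z \<circ> Inr)"
  using assms by (simp add: lin_form_def sum.Plus)

text \<open>
Optimizing the continuous coordinates of both levels at once, under the additional constraint that the
follower's objective does not exceed its value at the given point, never leaves \<open>F\<close>. The bound on the
follower's objective belongs to the right-hand side, and has a bounded denominator by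
\<open>reaction_value_in_lattice\<close>. Hence every feasible point is dominated by one whose value is in
\<open>(1/D)\<int>\<close>.
\<close>

lemma bilevel_dominating_point_in_lattice:
  assumes r: "r1 \<le> n1" "r2 \<le> n2"
    and A1: "A1 \<in> carrier_mat m1 n1" and G1: "G1 \<in> carrier_mat m1 n2" and b1: "b1 \<in> carrier_vec m1"
    and A2: "A2 \<in> carrier_mat m2 n1" and G2: "G2 \<in> carrier_mat m2 n2" and b2: "b2 \<in> carrier_vec m2"
    and c: "c \<in> carrier_vec n1" and d1: "d1 \<in> carrier_vec n2" and d2: "d2 \<in> carrier_vec n2"
    and link: "linking_vars A2 \<subseteq> {..<r1}"
  defines "F \<equiv> bilevel_feasible r1 n1 r2 n2 A1 G1 b1 A2 G2 b2 d2"
    and "obj \<equiv> (\<lambda>(x, y). rvec c \<bullet> x + rvec d1 \<bullet> y)"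
  shows "\<exists>D::nat. 0 < D \<and> (\<forall>p\<in>F. \<forall>B. (\<forall>q\<in>F. B \<le> obj q) \<longrightarrow>
    (\<exists>q\<in>F. obj q \<le> obj p \<and> of_nat D * obj q \<in> \<int>))"
proof -
  let ?data = "($) b1 ` {..<m1} \<union> ($) b2 ` {..<m2}"
  have "finite ?data"
    by simp
  from common_denominator[OF this] obtain K0 :: nat where K0: "0 < K0"
    and K0_data: "\<forall>q\<in>?data. of_nat K0 * real_of_rat q \<in> \<int>"
    by (elim exE conjE) (rule that)
  have K0_b1: "of_nat K0 * real_of_rat (b1 $ i) \<in> \<int>" if "i < m1" for i
    by (intro K0_data[rule_format] UnI1 imageI) (use that in simp)
  have K0_b2: "of_nat K0 * real_of_rat (b2 $ i) \<in> \<int>" if "i < m2" for i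
    by (intro K0_data[rule_format] UnI2 imageI) (use that in simp)
  obtain K1 :: nat where K1: "0 < K1"
    and reaction: "\<And>x y. x \<in> mixed_int_orthant r1 n1 \<Longrightarrow> y \<in> reaction_set A2 G2 b2 d2 r2 n2 x \<Longrightarrow>
      of_nat K1 * (rvec d2 \<bullet> y) \<in> \<int>"
    using reaction_value_in_lattice[OF A2 G2 b2 d2 link r] by blast
  define K where "K = K0 * K1"
  have K: "0 < K"
    using K0 K1 by (simp add: K_def)
  \<comment> \<open>Rows: the leader's constraints, the follower's constraints, and \<open>- d2 v \<ge> - d2 y\<close>.\<close>
  define I :: "(nat + nat + unit) set" where "I = {..<m1} <+> ({..<m2} <+> {()})"
  define J :: "(nat + nat) set" where "J = {..<n1} <+> {..<n2}"
  define N :: "(nat + nat) set" where "N = {..<r1} <+> {..<r2}"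
  define a :: "nat + nat + unit \<Rightarrow> nat + nat \<Rightarrow> rat" where
    "a = case_sum (\<lambda>i. case_sum (\<lambda>j. A1 $$ (i, j)) (\<lambda>j. G1 $$ (i, j)))
      (case_sum (\<lambda>i. case_sum (\<lambda>j. A2 $$ (i, j)) (\<lambda>j. G2 $$ (i, j)))
        (\<lambda>_. case_sum (\<lambda>_. 0) (\<lambda>j. - (d2 $ j))))"
  define \<gamma> :: "nat + nat \<Rightarrow> rat" where "\<gamma> = case_sum (($) c) (($) d1)"
  define \<beta> :: "real vec \<Rightarrow> nat + nat + unit \<Rightarrow> real" where
    "\<beta> y = case_sum (\<lambda>i. of_rat (b1 $ i)) (case_sum (\<lambda>i. of_rat (b2 $ i)) (\<lambda>_. - (rvec d2 \<bullet> y)))"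
    for y
  have fin: "finite I" "finite J" "N \<subseteq> J"
    using r by (auto simp: I_def J_def N_def)
  obtain D where D_pos: "0 < D" and D: "\<forall>b z B.
    (\<forall>i\<in>I. of_nat K * b i \<in> \<int>) \<longrightarrow>
    (\<forall>j\<in>J. 0 \<le> z j) \<longrightarrow> (\<forall>j\<in>N. z j \<in> \<int>) \<longrightarrow> (\<forall>i\<in>I. b i \<le> lin_form J (a i) z) \<longrightarrow>
    (\<forall>w. (\<forall>j\<in>J. 0 \<le> w j) \<longrightarrow> (\<forall>j\<in>N. w j = z j) \<longrightarrow> (\<forall>i\<in>I. b i \<le> lin_form J (a i) w) \<longrightarrow>
         B \<le> lin_form J \<gamma> w) \<longrightarrow>
    (\<exists>w. (\<forall>j\<in>J. 0 \<le> w j) \<and> (\<forall>j\<in>N. w j = z j) \<and> (\<forall>i\<in>I. b i \<le> lin_form J (a i) w) \<and>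
         lin_form J \<gamma> w \<le> lin_form J \<gamma> z \<and> of_nat D * lin_form J \<gamma> w \<in> \<int>)"
    using mixed_integer_optimum_in_lattice[OF fin K, of a \<gamma>] by (elim exE conjE) (rule that)
  have "\<exists>q\<in>F. obj q \<le> obj (x, y) \<and> of_nat D * obj q \<in> \<int>"
    if xy: "(x, y) \<in> F" and B: "\<And>q. q \<in> F \<Longrightarrow> B \<le> obj q" for x y B
  proof -
    define z where "z = case_sum (($) x) (($) y)"
    define pt where "pt w = (vec n1 (w \<circ> Inl), vec n2 (w \<circ> Inr))" for w :: "nat + nat \<Rightarrow> real"
    have x: "x \<in> mixed_int_orthant r1 n1" and y: "y \<in> mixed_int_orthant r2 n2"
      "y \<in> param_polyhedron A1 G1 b1 n2 x" "y \<in> reaction_set A2 G2 b2 d2 r2 n2 x"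
      using xy by (auto simp: F_def bilevel_feasible_def)
    have y2: "y \<in> param_polyhedron A2 G2 b2 n2 x"
      using y(3) by (simp add: reaction_set_def is_arg_min_def)
    have feasible: "(\<forall>j\<in>J. 0 \<le> w j) \<and> (\<forall>i\<in>I. \<beta> y i \<le> lin_form J (a i) w) \<longleftrightarrow>
        (\<forall>j<n1. 0 \<le> u $ j) \<and> v \<in> param_polyhedron A1 G1 b1 n2 u \<and>
        v \<in> param_polyhedron A2 G2 b2 n2 u \<and> rvec d2 \<bullet> v \<le> rvec d2 \<bullet> y"
      and obj: "lin_form J \<gamma> w = obj (u, v)"
      if uv: "u \<in> carrier_vec n1" "v \<in> carrier_vec n2"
        "\<And>j. j < n1 \<Longrightarrow> w (Inl j) = u $ j" "\<And>j. j < n2 \<Longrightarrow> w (Inr j) = v $ j" for w u v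
    proof -
      have lin: "lin_form J (case_sum f g) w
          = lin_form {..<n1} f (($) u) + lin_form {..<n2} g (($) v)" for f g
        unfolding J_def lin_form_Plus[OF finite_lessThan finite_lessThan]
        by (intro arg_cong2[where f = "(+)"] lin_form_cong) (auto simp: uv)
      have neg: "lin_form {..<n2} (\<lambda>j. - (d2 $ j)) (($) v) = - (rvec d2 \<bullet> v)"
        unfolding scalar_prod_rvec[OF d2 uv(2)]
        by (simp add: lin_form_def of_rat_minus sum_negf)
      have zero: "lin_form {..<n1} (\<lambda>_. 0) (($) u) = 0"
        by (simp add: lin_form_def)
      have rows: "(\<forall>i\<in>I. \<beta> y i \<le> lin_form J (a i) w) \<longleftrightarrow>
        (\<forall>i<m1. of_rat (b1 $ i) - lin_form {..<n1} (\<lambda>j. A1 $$ (i, j)) (($) u)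
          \<le> lin_form {..<n2} (\<lambda>j. G1 $$ (i, j)) (($) v)) \<and>
        (\<forall>i<m2. of_rat (b2 $ i) - lin_form {..<n1} (\<lambda>j. A2 $$ (i, j)) (($) u)
          \<le> lin_form {..<n2} (\<lambda>j. G2 $$ (i, j)) (($) v)) \<and> rvec d2 \<bullet> v \<le> rvec d2 \<bullet> y"
        by (simp add: I_def \<beta>_def a_def Plus_def ball_Un lin neg zero diff_le_eq add.commute
            Ball_def[of "{..<_}"] conj_commute conj_left_commute)
      have signs: "(\<forall>j\<in>J. 0 \<le> w j) \<longleftrightarrow> (\<forall>j<n1. 0 \<le> u $ j) \<and> (\<forall>j<n2. 0 \<le> v $ j)"
        by (simp add: J_def Plus_def ball_Un uv Ball_def[of "{..<_}"])
      show "(\<forall>j\<in>J. 0 \<le> w j) \<and> (\<forall>i\<in>I. \<beta> y i \<le> lin_form J (a i) w) \<longleftrightarrow>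
        (\<forall>j<n1. 0 \<le> u $ j) \<and> v \<in> param_polyhedron A1 G1 b1 n2 u \<and>
        v \<in> param_polyhedron A2 G2 b2 n2 u \<and> rvec d2 \<bullet> v \<le> rvec d2 \<bullet> y"
        unfolding rows signs mem_param_polyhedron_iff[OF A1 G1 b1 uv(1)]
          mem_param_polyhedron_iff[OF A2 G2 b2 uv(1)]
        using uv(2) by blast
      show "lin_form J \<gamma> w = obj (u, v)"
        unfolding \<gamma>_def lin obj_def
        by (simp add: scalar_prod_rvec[OF c uv(1)] scalar_prod_rvec[OF d1 uv(2)])
    qed
    have xc: "x \<in> carrier_vec n1" and yc: "y \<in> carrier_vec n2"
      using x y by (auto simp: mem_mixed_int_orthant_iff)
    have z_feas: "\<forall>j\<in>J. 0 \<le> z j" "\<forall>i\<in>I. \<beta> y i \<le> lin_form J (a i) z"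
      and z_obj: "lin_form J \<gamma> z = obj (x, y)"
      using feasible[OF xc yc, of z] obj[OF xc yc, of z] x y y2
      by (auto simp: z_def mem_mixed_int_orthant_iff)
    have z_int: "\<forall>j\<in>N. z j \<in> \<int>"
      using x y by (auto simp: N_def z_def mem_mixed_int_orthant_iff)
    have lattice: "\<forall>i\<in>I. of_nat K * \<beta> y i \<in> \<int>"
    proof -
      have "of_nat (K0 * K1) * t \<in> \<int>" if "of_nat K0 * t \<in> \<int> \<or> of_nat K1 * t \<in> \<int>" for t :: real
        using that
      proof
        assume "of_nat K0 * t \<in> \<int>"
        then have "of_nat K1 * (of_nat K0 * t) \<in> \<int>" by simp
        then show ?thesis by (simp add: ac_simps)
      next
        assume "of_nat K1 * t \<in> \<int>"
        then have "of_nat K0 * (of_nat K1 * t) \<in> \<int>" by simp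
        then show ?thesis by (simp add: ac_simps)
      qed
      then show ?thesis
        using K0_b1 K0_b2 reaction[OF x y(3)]
        by (simp add: I_def \<beta>_def K_def Plus_def ball_Un del: of_nat_mult)
    qed
    have pt: "pt w \<in> F" "lin_form J \<gamma> w = obj (pt w)"
      if w: "\<forall>j\<in>J. 0 \<le> w j" "\<forall>j\<in>N. w j = z j" "\<forall>i\<in>I. \<beta> y i \<le> lin_form J (a i) w" for w
    proof -
      define u v where "u = vec n1 (w \<circ> Inl)" and "v = vec n2 (w \<circ> Inr)"
      have uv: "u \<in> carrier_vec n1" "v \<in> carrier_vec n2"
        "\<And>j. j < n1 \<Longrightarrow> w (Inl j) = u $ j" "\<And>j. j < n2 \<Longrightarrow> w (Inr j) = v $ j"
        by (auto simp: u_def v_def)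
      have ux: "u $ j = x $ j" if "j < r1" for j
        using that w(2) r(1) by (auto simp: u_def N_def z_def Plus_def ball_Un)
      have vy: "v $ j = y $ j" if "j < r2" for j
        using that w(2) r(2) by (auto simp: v_def N_def z_def Plus_def ball_Un)
      have "(\<forall>j<n1. 0 \<le> u $ j) \<and> v \<in> param_polyhedron A1 G1 b1 n2 u \<and>
        v \<in> param_polyhedron A2 G2 b2 n2 u \<and> rvec d2 \<bullet> v \<le> rvec d2 \<bullet> y"
        using feasible[OF uv] w by blast
      moreover from this have "u \<in> mixed_int_orthant r1 n1" "v \<in> mixed_int_orthant r2 n2"
        using uv(1) x y(1) ux vy mem_param_polyhedron_iff[OF A1 G1 b1 uv(1)]
        by (auto simp: mem_mixed_int_orthant_iff)
      ultimately have "(u, v) \<in> F"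
        using bilevel_feasible_exchange[OF A2 G2 b2 link r(1)] xy ux unfolding F_def by blast
      then show "pt w \<in> F"
        by (simp add: pt_def u_def v_def)
      show "lin_form J \<gamma> w = obj (pt w)"
        using obj[OF uv] by (simp add: pt_def u_def v_def)
    qed
    have lower: "\<forall>w. (\<forall>j\<in>J. 0 \<le> w j) \<longrightarrow> (\<forall>j\<in>N. w j = z j) \<longrightarrow>
        (\<forall>i\<in>I. \<beta> y i \<le> lin_form J (a i) w) \<longrightarrow> B \<le> lin_form J \<gamma> w"
      using pt B by simp
    from D[THEN spec, THEN spec, THEN spec, THEN mp, OF lattice, THEN mp, OF z_feas(1),
        THEN mp, OF z_int, THEN mp, OF z_feas(2), THEN mp, OF lower]
    obtain w where w: "\<forall>j\<in>J. 0 \<le> w j" "\<forall>j\<in>N. w j = z j" "\<forall>i\<in>I. \<beta> y i \<le> lin_form J (a i) w"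
      "lin_form J \<gamma> w \<le> lin_form J \<gamma> z" "of_nat D * lin_form J \<gamma> w \<in> \<int>"
      by (elim exE conjE) (rule that)
    show ?thesis
      using pt[OF w(1-3)] w(4,5) unfolding z_obj by (intro bexI[of _ "pt w"]) simp_all
  qed
  then have "\<exists>q\<in>F. obj q \<le> obj p \<and> of_nat D * obj q \<in> \<int>"
    if "p \<in> F" "\<forall>q\<in>F. B \<le> obj q" for p B
    using that by (cases p) blast
  then show ?thesis
    using D_pos by blast
qed

section \<open>Convex hull and attainment\<close>

text \<open>
The points whose objective is at least the infimum over \<open>F\<close> form a convex set that contains \<open>F\<close>, hence
also its convex hull. The condition \<open>p \<in> carrier_vec n1 \<times> carrier_vec n2\<close> is part of that set because
vectors of different dimensions do not combine linearly.
\<close>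

lemma opt_value_conv:
  assumes F: "F \<subseteq> carrier_vec n1 \<times> carrier_vec n2"
    and c: "c \<in> carrier_vec n1" and d: "d \<in> carrier_vec n2"
  defines "obj \<equiv> (\<lambda>(x, y). c \<bullet> x + d \<bullet> y)"
  shows "opt_value obj (conv F) = opt_value obj F"
proof (rule antisym)
  show "opt_value obj (conv F) \<le> opt_value obj F"
    unfolding opt_value_def conv_def by (intro INF_superset_mono hull_subset) simp
  define S where "S = {p \<in> carrier_vec n1 \<times> carrier_vec n2. opt_value obj F \<le> ereal (obj p)}"
  have "convex_pairs S"
    unfolding convex_pairs_def
  proof (intro ballI allI impI)
    fix p q and u v :: real
    assume p: "p \<in> S" and q: "q \<in> S" and uv: "0 \<le> u" "0 \<le> v" "u + v = 1"
    obtain x y x' y' where [simp]: "p = (x, y)" "q = (x', y')"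
      by (cases p, cases q)
    have car: "x \<in> carrier_vec n1" "x' \<in> carrier_vec n1" "y \<in> carrier_vec n2" "y' \<in> carrier_vec n2"
      using p q by (auto simp: S_def)
    have "obj (u \<cdot>\<^sub>v x + v \<cdot>\<^sub>v x', u \<cdot>\<^sub>v y + v \<cdot>\<^sub>v y') = u * obj p + v * obj q"
      using car c d by (simp add: obj_def scalar_prod_add_distrib[of _ n1] scalar_prod_add_distrib[of _ n2]
          algebra_simps)
    moreover have "min (obj p) (obj q) \<le> u * obj p + v * obj q"
    proof -
      have "u * min (obj p) (obj q) + v * min (obj p) (obj q) \<le> u * obj p + v * obj q"
        using uv by (intro add_mono mult_left_mono) auto
      then show ?thesis
        using uv(3) by (simp add: distrib_right[symmetric])
    qed
    moreover have "opt_value obj F \<le> ereal (min (obj p) (obj q))"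
      using p q by (simp add: S_def min_def)
    ultimately have "opt_value obj F \<le> ereal (obj (u \<cdot>\<^sub>v x + v \<cdot>\<^sub>v x', u \<cdot>\<^sub>v y + v \<cdot>\<^sub>v y'))"
      by (metis ereal_less_eq(3) order_trans)
    then show "(u \<cdot>\<^sub>v fst p + v \<cdot>\<^sub>v fst q, u \<cdot>\<^sub>v snd p + v \<cdot>\<^sub>v snd q) \<in> S"
      using car by (simp add: S_def)
  qed
  moreover have "F \<subseteq> S"
    using F by (auto simp: S_def opt_value_def intro: INF_lower)
  ultimately have "conv F \<subseteq> S"
    unfolding conv_def by (intro hull_minimal)
  then show "opt_value obj F \<le> opt_value obj (conv F)"
    unfolding opt_value_def[of obj "conv F"] by (intro INF_greatest) (auto simp: S_def)
qed

text \<open>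
Among the points with value in \<open>(1/D)\<int>\<close> there is one of least value, since these values are bounded
below by the infimum \<open>L\<close>. Every point is dominated by such a point, so this value is the minimum.
\<close>

lemma attained_if_dominated_by_lattice_values:
  fixes f :: "'a \<Rightarrow> real" and D :: nat
  assumes D: "0 < D"
    and dom: "\<And>p B. p \<in> S \<Longrightarrow> (\<forall>q\<in>S. B \<le> f q) \<Longrightarrow> \<exists>q\<in>S. f q \<le> f p \<and> of_nat D * f q \<in> \<int>"
  shows "attained_if_finite f S"
  unfolding attained_if_finite_def
proof
  assume "\<bar>opt_value f S\<bar> \<noteq> \<infinity>"
  then obtain L where L: "opt_value f S = ereal L"
    by auto
  have bound: "L \<le> f q" if "q \<in> S" for q
    using INF_lower[OF that, of "\<lambda>s. ereal (f s)"] L by (simp add: opt_value_def)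
  have "S \<noteq> {}"
    using L by (auto simp: opt_value_def top_ereal_def)
  \<comment> \<open>The difference is nonnegative on \<open>S\<close>, so the conversion to \<open>nat\<close> preserves it.\<close>
  define m where "m q = nat (\<lfloor>of_nat D * f q\<rfloor> - \<lfloor>of_nat D * L\<rfloor>)" for q
  obtain p where "p \<in> S" "of_nat D * f p \<in> \<int>"
    using dom bound \<open>S \<noteq> {}\<close> by blast
  then obtain q0 where q0: "q0 \<in> S" "of_nat D * f q0 \<in> \<int>"
    and least: "\<And>q. q \<in> S \<Longrightarrow> of_nat D * f q \<in> \<int> \<Longrightarrow> m q0 \<le> m q"
    using ex_has_least_nat[of "\<lambda>q. q \<in> S \<and> of_nat D * f q \<in> \<int>" p m] by blast
  have "f q0 \<le> f p" if p: "p \<in> S" for p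
  proof -
    obtain q where q: "q \<in> S" "f q \<le> f p" "of_nat D * f q \<in> \<int>"
      using dom[OF p] bound by blast
    have "\<lfloor>of_nat D * L\<rfloor> \<le> \<lfloor>of_nat D * f q\<rfloor>" "\<lfloor>of_nat D * L\<rfloor> \<le> \<lfloor>of_nat D * f q0\<rfloor>"
      using bound q(1) q0(1) by (auto intro!: floor_mono mult_left_mono)
    then have "\<lfloor>of_nat D * f q0\<rfloor> \<le> \<lfloor>of_nat D * f q\<rfloor>"
      using least[OF q(1,3)] by (simp add: m_def)
    then have "of_nat D * f q0 \<le> of_nat D * f q"
      using q(3) q0(2) by (auto elim!: Ints_cases)
    then show ?thesis
      using D q(2) by simp
  qed
  then have "opt_value f S = ereal (f q0)"
    unfolding opt_value_def using q0(1) by (intro antisym INF_lower INF_greatest) auto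
  then show "\<exists>s\<in>S. ereal (f s) = opt_value f S"
    using q0(1) by auto
qed

theorem theorem2:
  fixes r1 n1 r2 n2 m1 m2 :: nat
    and A1 G1 A2 G2 :: "rat mat"
    and b1 b2 c d1 d2 :: "rat vec"
  defines "F \<equiv> bilevel_feasible r1 n1 r2 n2 A1 G1 b1 A2 G2 b2 d2"
    and "obj \<equiv> (\<lambda>(x, y). rvec c \<bullet> x + rvec d1 \<bullet> y)"
  assumes "r1 \<le> n1" and "r2 \<le> n2"
    and "A1 \<in> carrier_mat m1 n1" and "G1 \<in> carrier_mat m1 n2" and "b1 \<in> carrier_vec m1"
    and "A2 \<in> carrier_mat m2 n1" and "G2 \<in> carrier_mat m2 n2" and "b2 \<in> carrier_vec m2"
    and "c \<in> carrier_vec n1" and "d1 \<in> carrier_vec n2" and "d2 \<in> carrier_vec n2"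
    and "linking_vars A2 \<subseteq> {..<r1}"
  shows "opt_value obj F = opt_value obj (conv F)
    \<and> attained_if_finite obj F \<and> attained_if_finite obj (conv F)"
proof -
  have "F \<subseteq> carrier_vec n1 \<times> carrier_vec n2"
    by (auto simp: F_def bilevel_feasible_def mem_mixed_int_orthant_iff)
  then have opt: "opt_value obj (conv F) = opt_value obj F"
    unfolding obj_def using assms by (intro opt_value_conv) auto
  obtain D :: nat where "0 < D"
    "\<And>p B. p \<in> F \<Longrightarrow> (\<forall>q\<in>F. B \<le> obj q) \<Longrightarrow> \<exists>q\<in>F. obj q \<le> obj p \<and> of_nat D * obj q \<in> \<int>"
    using bilevel_dominating_point_in_lattice[OF assms(3-14)] unfolding F_def obj_def by blast
  then have att: "attained_if_finite obj F"
    by (rule attained_if_dominated_by_lattice_values)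
  moreover have "F \<subseteq> conv F"
    unfolding conv_def by (rule hull_subset)
  ultimately have "attained_if_finite obj (conv F)"
    unfolding attained_if_finite_def opt by auto
  then show ?thesis
    using opt att by simp
qed

end
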